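(* Let $|\mathbb{S}\rangle=(|1\rangle-|2\rangle)/\sqrt2\in\mathbb{C}^3$ be the Strange state, let $\rho_0=|\mathbb{S}\rangle\langle\mathbb{S}|$, and let $\rho_1=(\mathbb{1}-|\mathbb{S}\rangle\langle\mathbb{S}|)/2$ be its orthogonal complement. For every positive integer $n$, $$P_{\mathrm{e}}^{\mathrm{PWF}}\big(\rho_0^{\otimes n},\rho_1^{\otimes n},\tfrac12\big)=\frac{1}{2^{n+1}}.$$ The optimal PWF POVM is $\{E,\mathbb{1}-E\}$, where $E=(|\mathbb{K}\rangle\langle\mathbb{K}|+|\mathbb{S}\rangle\langle\mathbb{S}|)^{\otimes n}$ and $|\mathbb{K}\rangle=(|1\rangle+|2\rangle)/\sqrt2$.
   Context: The system is a qutrit $\mathbb{C}^3$ ($d=3$) with computational basis $\{|0\rangle,|1\rangle,|2\rangle\}$. Phase-space operators. Let $X|j\rangle=|j+1 \bmod 3\rangle$, $Z|j\rangle=e^{2\pi i j/3}|j\rangle$. For $\mathbf{u}=(a_1,a_2)\in\mathbb{Z}_3\times\mathbb{Z}_3$ let $T_{\mathbf{u}}=e^{-4\pi i a_1a_2/3}Z^{a_1}X^{a_2}$, $A_{\mathbf{0}}=\frac13\sum_{\mathbf{u}}T_{\mathbf{u}}$, $A_{\mathbf{u}}=T_{\mathbf{u}}A_{\mathbf{0}}T_{\mathbf{u}}^\dagger$. On $n$ qutrits the phase-space points are $\mathbf{u}=(\mathbf{u}_1,\dots,\mathbf{u}_n)\in(\mathbb{Z}_3\times\mathbb{Z}_3)^n$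 and $A_{\mathbf{u}}=A_{\mathbf{u}_1}\otimes\cdots\otimes A_{\mathbf{u}_n}$. The discrete Wigner function of a POVM effect $F$ is $W(F|\mathbf{u})=\operatorname{Tr}[FA_{\mathbf{u}}]$. A PWF POVM (POVM with positive discrete Wigner functions) is a POVM each of whose effects $F$ satisfies $W(F|\mathbf{u})\ge0$ for all $\mathbf{u}$. Optimal error probability. For states $\sigma_0,\sigma_1$ on a given system with prior probabilities $p$ and $1-p$, $P_{\mathrm{e}}^{\mathrm{PWF}}(\sigma_0,\sigma_1,p)$ is the minimum of $(1-p)\operatorname{Tr}(E_0\sigma_1)+p\operatorname{Tr}(E_1\sigma_0)$ over all two-outcome PWF POVMs $\{E_0,E_1\}$, i.e. $E_0,E_1\ge0$, $E_0+E_1=\mathbb{1}$, and $W(E_0|\mathbf{u}),W(E_1|\mathbf{u})\ge0$ for all $\mathbf{u}$. In the POVM $\{E,\mathbb{1}-E\}$ of the claim, $E_0=E$ and $E_1=\mathbb{1}-E$. *)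

theory Defs
  imports Complex_Main "Jordan_Normal_Form.Schur_Decomposition"
begin

definition ketbra :: "complex vec \<Rightarrow> complex vec \<Rightarrow> complex mat" where
  "ketbra v w = mat (dim_vec v) (dim_vec w) (\<lambda>(i, j). v $ i * cnj (w $ j))"

definition mtrace :: "complex mat \<Rightarrow> complex" where
  "mtrace A = (\<Sum>i<dim_row A. A $$ (i, i))"

text \<open>Kronecker product: the basis vector \<open>|i\<rangle> \<otimes> |k\<rangle>\<close> has index
  \<open>i * dim B + k\<close>, i.e. the first factor is the most significant digit.\<close>

definition kron :: "complex mat \<Rightarrow> complex mat \<Rightarrow> complex mat" where
  "kron A B = mat (dim_row A * dim_row B) (dim_col A * dim_col B)
     (\<lambda>(i, j). A $$ (i div dim_row B, j div dim_col B) * B $$ (i mod dim_row B, j mod dim_col B))"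

fun kron_list :: "complex mat list \<Rightarrow> complex mat" where
  "kron_list [] = 1\<^sub>m 1"
| "kron_list (A # As) = kron A (kron_list As)"

definition tensor_power :: "nat \<Rightarrow> complex mat \<Rightarrow> complex mat" where
  "tensor_power n A = kron_list (replicate n A)"

text \<open>The order on \<^typ>\<open>complex\<close> is the one of \<open>Complex_Order\<close>: \<open>0 \<le> z\<close> means that \<open>z\<close>
  is real and nonnegative. The form \<open>(A *\<^sub>v v) \<bullet>c v\<close> is \<open>\<langle>v|A|v\<rangle>\<close>.\<close>

definition psd :: "nat \<Rightarrow> complex mat \<Rightarrow> bool" where
  "psd d A \<longleftrightarrow> A \<in> carrier_mat d d \<and> mat_adjoint A = A \<and>
     (\<forall>v \<in> carrier_vec d. 0 \<le> (A *\<^sub>v v) \<bullet>c v)"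

definition shift_X :: "complex mat" where
  "shift_X = mat 3 3 (\<lambda>(i, j). if i = (j + 1) mod 3 then 1 else 0)"

definition clock_Z :: "complex mat" where
  "clock_Z = mat 3 3 (\<lambda>(i, j). if i = j then cis (2 * pi * real j / 3) else 0)"

text \<open>Elements of \<open>\<int>\<^sub>3 \<times> \<int>\<^sub>3\<close> are given by their representatives in \<open>{0..<3} \<times> {0..<3}\<close>; all the
  expressions below depend only on the residue classes.\<close>

definition Z3_points :: "(nat \<times> nat) set" where
  "Z3_points = {0..<3} \<times> {0..<3}"

definition phase_T :: "nat \<times> nat \<Rightarrow> complex mat" where
  "phase_T = (\<lambda>(a1, a2). cis (- (4 * pi * real a1 * real a2 / 3)) \<cdot>\<^sub>m
     (clock_Z ^\<^sub>m a1 * shift_X ^\<^sub>m a2))"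

text \<open>Matrices of varying dimension do not form an additive monoid type, hence the entrywise sum.\<close>

definition phase_A0 :: "complex mat" where
  "phase_A0 = (1 / 3) \<cdot>\<^sub>m mat 3 3 (\<lambda>(i, j). \<Sum>u \<in> Z3_points. phase_T u $$ (i, j))"

definition phase_A :: "nat \<times> nat \<Rightarrow> complex mat" where
  "phase_A u = phase_T u * phase_A0 * mat_adjoint (phase_T u)"

definition phase_space :: "nat \<Rightarrow> (nat \<times> nat) list set" where
  "phase_space n = {us. length us = n \<and> set us \<subseteq> Z3_points}"

definition phase_op :: "(nat \<times> nat) list \<Rightarrow> complex mat" where
  "phase_op us = kron_list (map phase_A us)"

definition wigner :: "complex mat \<Rightarrow> (nat \<times> nat) list \<Rightarrow> complex" where
  "wigner F us = mtrace (F * phase_op us)"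

definition pwf_povm :: "nat \<Rightarrow> complex mat \<times> complex mat \<Rightarrow> bool" where
  "pwf_povm n = (\<lambda>(E0, E1). psd (3 ^ n) E0 \<and> psd (3 ^ n) E1 \<and> E0 + E1 = 1\<^sub>m (3 ^ n) \<and>
     (\<forall>us \<in> phase_space n. 0 \<le> wigner E0 us \<and> 0 \<le> wigner E1 us))"

text \<open>The traces are real for Hermitian effects and states; \<^const>\<open>Re\<close> only adjusts the type.\<close>

definition error_prob ::
    "complex mat \<Rightarrow> complex mat \<Rightarrow> real \<Rightarrow> complex mat \<times> complex mat \<Rightarrow> real" where
  "error_prob \<sigma>0 \<sigma>1 p =
     (\<lambda>(E0, E1). (1 - p) * Re (mtrace (E0 * \<sigma>1)) + p * Re (mtrace (E1 * \<sigma>0)))"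

text \<open>For states and \<open>0 \<le> p \<le> 1\<close> the values are bounded below by 0, and the set is nonempty
  (\<open>E0 = E1 = 1/2\<close>), so the infimum is a genuine one.\<close>

definition P_e_PWF :: "nat \<Rightarrow> complex mat \<Rightarrow> complex mat \<Rightarrow> real \<Rightarrow> real" where
  "P_e_PWF n \<sigma>0 \<sigma>1 p = (INF E \<in> {E. pwf_povm n E}. error_prob \<sigma>0 \<sigma>1 p E)"

definition strange :: "complex vec" where
  "strange = complex_of_real (1 / sqrt 2) \<cdot>\<^sub>v (unit_vec 3 1 - unit_vec 3 2)"

definition ket_K :: "complex vec" where
  "ket_K = complex_of_real (1 / sqrt 2) \<cdot>\<^sub>v (unit_vec 3 1 + unit_vec 3 2)"

definition rho0 :: "complex mat" where
  "rho0 = ketbra strange strange"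

definition rho1 :: "complex mat" where
  "rho1 = (1 / 2) \<cdot>\<^sub>m (1\<^sub>m 3 - ketbra strange strange)"

definition E_opt :: "nat \<Rightarrow> complex mat" where
  "E_opt n = tensor_power n (ketbra ket_K ket_K + ketbra strange strange)"

end

theory Submission
  imports Defs
begin

text \<open>
  The operator \<open>A\<close> attached to the origin of phase space is the parity \<open>|j\<rangle> \<mapsto> |-j\<rangle>\<close>, so that
  \<open>\<rho>\<^sub>0 = (1 - A) / 2\<close> and \<open>2\<rho>\<^sub>1 = (1 + A) / 2\<close>. Expanding the tensor powers, the even terms cancel in
  \<open>D = (2\<rho>\<^sub>1)\<^sup>\<otimes>\<^sup>n - \<rho>\<^sub>0\<^sup>\<otimes>\<^sup>n\<close> and the odd ones add up, so \<open>D\<close> is a nonnegative combination of phase-space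
  operators (the identity being a third of the sum of all nine of them). Hence \<open>Tr (E\<^sub>0 D) \<ge> 0\<close> for every PWF
  effect \<open>E\<^sub>0\<close>. With \<open>t = Tr (E\<^sub>1 \<rho>\<^sub>0\<^sup>\<otimes>\<^sup>n) \<ge> 0\<close> the error probability is therefore at least
  \<open>(2\<^sup>-\<^sup>n (1 - t) + t) / 2 \<ge> 2\<^sup>-\<^sup>n / 2\<close>. Conversely the effect \<open>E\<close> is a diagonal projection whose
  Wigner function takes only the values 0 and 1.
\<close>

section \<open>Index arithmetic and Kronecker products\<close>

lemma div_mod_less:
  assumes "k < a * (b::nat)"
  shows "k div b < a \<and> k mod b < b"
proof -
  have "b \<noteq> 0" using assms by (intro notI) simp
  then show ?thesis using less_mult_imp_div_less[OF assms] by simp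
qed

text \<open>The bijection between \<open>k\<close> and its digit pair
  \<open>(k div b, k mod b)\<close> turns a sum over a Kronecker index into a double sum over the
  factors. For \<open>b = 0\<close> both sides are empty.\<close>

lemma sum_div_mod:
  fixes f :: "nat \<Rightarrow> nat \<Rightarrow> 'a::comm_monoid_add"
  shows "(\<Sum>k<a * b. f (k div b) (k mod b)) = (\<Sum>i<a. \<Sum>j<b. f i j)"
proof (cases "b = 0")
  case False
  have "(\<Sum>k<a * b. f (k div b) (k mod b)) = (\<Sum>(i, j) \<in> {..<a} \<times> {..<b}. f i j)"
  proof (rule sum.reindex_bij_witness[where i = "\<lambda>(i, j). i * b + j" and j = "\<lambda>k. (k div b, k mod b)"])
    fix x assume "x \<in> {..<a} \<times> {..<b}"
    then obtain i j where x: "x = (i, j)" "i < a" "j < b" by auto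
    have "i * b + j < Suc i * b" using x by simp
    also have "\<dots> \<le> a * b" using x by (intro mult_le_mono1) simp
    finally show "(\<lambda>(i, j). i * b + j) x \<in> {..<a * b}" using x by simp
    show "(((\<lambda>(i, j). i * b + j) x) div b, ((\<lambda>(i, j). i * b + j) x) mod b) = x"
      using x by simp
  next
    fix k assume "k \<in> {..<a * b}"
    then show "(k div b, k mod b) \<in> {..<a} \<times> {..<b}"
      using div_mod_less[of k a b] by simp
  qed simp_all
  also have "\<dots> = (\<Sum>i<a. \<Sum>j<b. f i j)"
    by (rule sum.cartesian_product[symmetric])
  finally show ?thesis .
qed simp

lemma less_3_iff: "i < (3::nat) \<longleftrightarrow> i = 0 \<or> i = 1 \<or> i = 2"
  by auto

lemma dim_kron [simp]:
  "dim_row (kron A B) = dim_row A * dim_row B"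
  "dim_col (kron A B) = dim_col A * dim_col B"
  by (simp_all add: kron_def)

lemma kron_carrier [simp]:
  "A \<in> carrier_mat m n \<Longrightarrow> B \<in> carrier_mat p q \<Longrightarrow> kron A B \<in> carrier_mat (m * p) (n * q)"
  by (intro carrier_matI) simp_all

lemma index_kron:
  "i < dim_row A * dim_row B \<Longrightarrow> j < dim_col A * dim_col B \<Longrightarrow>
    kron A B $$ (i, j) = A $$ (i div dim_row B, j div dim_col B) * B $$ (i mod dim_row B, j mod dim_col B)"
  by (simp add: kron_def)

text \<open>The contracted index of the product is itself a digit pair, so the sum over it splits
  into two sums, one for each factor.\<close>

lemma kron_mult:
  assumes "dim_col A = dim_row C" "dim_col B = dim_row D"
  shows "kron A B * kron C D = kron (A * C) (B * D)"
proof (rule eq_matI)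
  fix i j assume "i < dim_row (kron (A * C) (B * D))" "j < dim_col (kron (A * C) (B * D))"
  then have ij: "i < dim_row A * dim_row B" "j < dim_col C * dim_col D" by simp_all
  note ij' = div_mod_less[OF ij(1)] div_mod_less[OF ij(2)]
  let ?f = "\<lambda>k l. A $$ (i div dim_row B, k) * B $$ (i mod dim_row B, l)
      * (C $$ (k, j div dim_col D) * D $$ (l, j mod dim_col D))"
  have "(kron A B * kron C D) $$ (i, j)
      = (\<Sum>k<dim_row C * dim_row D. ?f (k div dim_row D) (k mod dim_row D))"
    using ij assms by (simp add: scalar_prod_def index_kron lessThan_atLeast0)
  also have "\<dots> = (\<Sum>k<dim_row C. \<Sum>l<dim_row D. ?f k l)"
    by (rule sum_div_mod)
  also have "\<dots> = kron (A * C) (B * D) $$ (i, j)"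
    using ij ij' assms
    by (simp add: scalar_prod_def index_kron lessThan_atLeast0 sum_product mult_ac)
  finally show "(kron A B * kron C D) $$ (i, j) = kron (A * C) (B * D) $$ (i, j)" .
qed simp_all

lemma mtrace_kron:
  assumes "A \<in> carrier_mat m m" "B \<in> carrier_mat n n"
  shows "mtrace (kron A B) = mtrace A * mtrace B"
proof -
  have "mtrace (kron A B) = (\<Sum>k<m * n. A $$ (k div n, k div n) * B $$ (k mod n, k mod n))"
    using assms by (auto simp: mtrace_def index_kron intro!: sum.cong)
  also have "\<dots> = (\<Sum>i<m. \<Sum>j<n. A $$ (i, i) * B $$ (j, j))"
    by (rule sum_div_mod)
  finally show ?thesis
    using assms by (simp add: mtrace_def sum_product)
qed

lemma mat_adjoint_eq:
  "mat_adjoint A = mat (dim_col A) (dim_row A) (\<lambda>(i, j). cnj (A $$ (j, i)))"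
  by (rule eq_matI) (simp_all add: mat_adjoint_def mat_of_rows_def)

lemma mat_adjoint_kron: "mat_adjoint (kron A B) = kron (mat_adjoint A) (mat_adjoint B)"
  by (rule eq_matI) (simp_all add: mat_adjoint_eq index_kron div_mod_less)

lemma mtrace_add:
  "A \<in> carrier_mat n n \<Longrightarrow> B \<in> carrier_mat n n \<Longrightarrow> mtrace (A + B) = mtrace A + mtrace B"
  by (simp add: mtrace_def sum.distrib)

lemma mtrace_smult: "A \<in> carrier_mat n n \<Longrightarrow> mtrace (c \<cdot>\<^sub>m A) = c * mtrace A"
  by (simp add: mtrace_def sum_distrib_left)


section \<open>Tensor powers and products over lists\<close>

lemma kron_list_carrier:
  "\<forall>A \<in> set As. A \<in> carrier_mat d d \<Longrightarrow> kron_list As \<in> carrier_mat (d ^ length As) (d ^ length As)"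
  by (induction As) auto

lemma tensor_power_carrier [simp]:
  "A \<in> carrier_mat d d \<Longrightarrow> tensor_power n A \<in> carrier_mat (d ^ n) (d ^ n)"
  using kron_list_carrier[of "replicate n A" d] by (simp add: tensor_power_def)

lemma tensor_power_0 [simp]: "tensor_power 0 A = 1\<^sub>m 1"
  and tensor_power_Suc [simp]: "tensor_power (Suc n) A = kron A (tensor_power n A)"
  by (simp_all add: tensor_power_def)

lemma mtrace_kron_list:
  "\<forall>A \<in> set As. A \<in> carrier_mat d d \<Longrightarrow> mtrace (kron_list As) = prod_list (map mtrace As)"
proof (induction As)
  case (Cons A As)
  then show ?case using mtrace_kron[of A d "kron_list As"] kron_list_carrier[of As d] by simp
qed (simp add: mtrace_def)

text \<open>Iterated mixed-product rule. The right factor is a list because a phase-space operator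
  may differ from qutrit to qutrit, while the effect is the same on each.\<close>

lemma tensor_power_mult_kron_list:
  assumes "A \<in> carrier_mat d d" "\<forall>B \<in> set Bs. B \<in> carrier_mat d d"
  shows "tensor_power (length Bs) A * kron_list Bs = kron_list (map ((*) A) Bs)"
  using assms(2)
proof (induction Bs)
  case (Cons B Bs)
  have "dim_col (tensor_power (length Bs) A) = d ^ length Bs"
    using tensor_power_carrier[OF assms(1)] by blast
  moreover have "dim_row (kron_list Bs) = d ^ length Bs" "dim_row B = d"
    using Cons.prems kron_list_carrier[of Bs d] by (meson carrier_matD list.set_intros)+
  ultimately have "kron A (tensor_power (length Bs) A) * kron B (kron_list Bs)
      = kron (A * B) (tensor_power (length Bs) A * kron_list Bs)"
    using assms(1) by (simp add: kron_mult)
  with Cons show ?case by simp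
qed simp

lemma tensor_power_mult:
  assumes "A \<in> carrier_mat d d" "B \<in> carrier_mat d d"
  shows "tensor_power n A * tensor_power n B = tensor_power n (A * B)"
  using tensor_power_mult_kron_list[of A d "replicate n B"] assms
  by (simp add: tensor_power_def)

lemma mtrace_tensor_power:
  assumes "A \<in> carrier_mat d d"
  shows "mtrace (tensor_power n A) = mtrace A ^ n"
  using mtrace_kron_list[of "replicate n A" d] assms by (simp add: tensor_power_def)

lemma mat_adjoint_tensor_power:
  "mat_adjoint (tensor_power n A) = tensor_power n (mat_adjoint A)"
proof (induction n)
  case 0
  show ?case by (rule eq_matI) (auto simp: mat_adjoint_eq)
qed (simp add: mat_adjoint_kron)

section \<open>Adjoints, projections and rank-one operators\<close>

lemma cscalar_mat_adjoint:
  fixes A :: "complex mat"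
  assumes "A \<in> carrier_mat m n" "v \<in> carrier_vec n" "w \<in> carrier_vec m"
  shows "(A *\<^sub>v v) \<bullet>c w = v \<bullet>c (mat_adjoint A *\<^sub>v w)"
proof -
  have "(A *\<^sub>v v) \<bullet>c w = (\<Sum>i<m. \<Sum>j<n. A $$ (i, j) * v $ j * cnj (w $ i))"
    using assms by (simp add: scalar_prod_def sum_distrib_right lessThan_atLeast0)
  also have "\<dots> = (\<Sum>j<n. \<Sum>i<m. A $$ (i, j) * v $ j * cnj (w $ i))"
    by (rule sum.swap)
  also have "\<dots> = v \<bullet>c (mat_adjoint A *\<^sub>v w)"
    using assms
    by (simp add: scalar_prod_def sum_distrib_left lessThan_atLeast0 mat_adjoint_eq mult_ac)
  finally show ?thesis .
qed

text \<open>The quadratic form of an orthogonal projection at \<open>v\<close> is the squared norm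
  of \<open>P *\<^sub>v v\<close>.\<close>

lemma psd_projection:
  assumes P: "P \<in> carrier_mat d d" and adj: "mat_adjoint P = P" and idem: "P * P = P"
  shows "psd d P"
  unfolding psd_def
proof (intro conjI ballI)
  fix v :: "complex vec" assume v: "v \<in> carrier_vec d"
  have "(P *\<^sub>v v) \<bullet>c v = (P *\<^sub>v (P *\<^sub>v v)) \<bullet>c v"
    using P v idem assoc_mult_mat_vec[of P d d P d v] by simp
  also have "\<dots> = (P *\<^sub>v v) \<bullet>c (P *\<^sub>v v)"
    using P v adj by (subst cscalar_mat_adjoint[of _ d d]) auto
  finally show "0 \<le> (P *\<^sub>v v) \<bullet>c v"
    by (simp add: conjugate_square_ge_0_vec)
qed fact+

text \<open>The complement is again a Hermitian idempotent.\<close>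

lemma psd_projection_compl:
  assumes P: "P \<in> carrier_mat d d" and adj: "mat_adjoint P = P" and idem: "P * P = P"
  shows "psd d (1\<^sub>m d - P)"
proof (rule psd_projection)
  have "cnj (P $$ (i, j)) = P $$ (j, i)" if "i < d" "j < d" for i j
    using arg_cong[OF adj, of "\<lambda>M. M $$ (j, i)"] P that by (simp add: mat_adjoint_eq)
  then show "mat_adjoint (1\<^sub>m d - P) = 1\<^sub>m d - P"
    using P by (intro eq_matI) (auto simp: mat_adjoint_eq)
  have "(1\<^sub>m d - P) * (1\<^sub>m d - P) = 1\<^sub>m d * (1\<^sub>m d - P) - P * (1\<^sub>m d - P)"
    using P by (intro minus_mult_distrib_mat) auto
  also have "\<dots> = 1\<^sub>m d - P - (P - P * P)"
    using P mult_minus_distrib_mat[OF P one_carrier_mat P] by simp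
  finally show "(1\<^sub>m d - P) * (1\<^sub>m d - P) = 1\<^sub>m d - P"
    using P idem by (intro eq_matI) auto
qed (use P in auto)

lemma mtrace_mult_ketbra:
  assumes "A \<in> carrier_mat d d" "v \<in> carrier_vec d"
  shows "mtrace (A * ketbra v v) = (A *\<^sub>v v) \<bullet>c v"
  using assms
  by (simp add: mtrace_def ketbra_def scalar_prod_def sum_distrib_left sum_distrib_right
      lessThan_atLeast0 mult_ac)

text \<open>Keeps the power of a pure state pure, so that its trace against a positive semidefinite
  effect is a value of a quadratic form and hence nonnegative.\<close>

lemma tensor_power_ketbra:
  assumes "v \<in> carrier_vec d"
  shows "\<exists>w \<in> carrier_vec (d ^ n). tensor_power n (ketbra v v) = ketbra w w"
proof (induction n)
  case 0
  have "tensor_power 0 (ketbra v v) = ketbra (unit_vec 1 0) (unit_vec 1 0)"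
    by (rule eq_matI) (auto simp: ketbra_def)
  then show ?case by (metis power_0 unit_vec_carrier)
next
  case (Suc n)
  then obtain w where w: "w \<in> carrier_vec (d ^ n)" "tensor_power n (ketbra v v) = ketbra w w"
    by blast
  \<comment> \<open>The coordinates of the tensor product of \<open>v\<close> and \<open>w\<close>,
    with the first factor as the most significant digit, as in \<open>kron\<close>.\<close>
  let ?u = "vec (d * d ^ n) (\<lambda>k. v $ (k div d ^ n) * w $ (k mod d ^ n))"
  have "kron (ketbra v v) (ketbra w w) = ketbra ?u ?u"
    using assms w(1)
    by (intro eq_matI) (auto simp: ketbra_def index_kron div_mod_less)
  with w have "tensor_power (Suc n) (ketbra v v) = ketbra ?u ?u" by simp
  moreover have "?u \<in> carrier_vec (d ^ Suc n)" by simp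
  ultimately show ?case by blast
qed

section \<open>The primitive cube root of unity\<close>

definition omega :: complex where
  "omega = cis (2 * pi / 3)"

lemma omega_pow3: "omega ^ 3 = 1"
  by (simp add: omega_def DeMoivre)

lemma omega_power_mod: "omega ^ k = omega ^ (k mod 3)"
proof -
  have "omega ^ k = (omega ^ 3) ^ (k div 3) * omega ^ (k mod 3)"
    by (simp flip: power_mult power_add)
  then show ?thesis by (simp add: omega_pow3)
qed

text \<open>Factor \<open>omega ^ 3 - 1\<close> and cancel \<open>omega - 1\<close>, which is
  nonzero because the real part of \<open>omega\<close> is -1/2.\<close>

lemma omega_sum: "1 + omega + omega\<^sup>2 = 0"
proof -
  have "cos (2 * pi / 3) = - 1 / 2"
    using cos_120 by simp
  then have "omega \<noteq> 1"
    by (auto simp: omega_def complex_eq_iff)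
  moreover have "(omega - 1) * (1 + omega + omega\<^sup>2) = 0"
    using omega_pow3 by (simp add: algebra_simps power2_eq_square power3_eq_cube)
  ultimately show ?thesis by simp
qed

lemma cnj_omega: "cnj omega = omega\<^sup>2"
proof -
  have "cnj omega * omega = 1"
    by (simp add: omega_def cis_cnj cis_mult)
  then have "cnj omega * omega * omega\<^sup>2 = omega\<^sup>2" by simp
  moreover have "cnj omega * omega * omega\<^sup>2 = cnj omega * omega ^ 3"
    by (simp add: power2_eq_square power3_eq_cube)
  ultimately show ?thesis by (simp add: omega_pow3)
qed

text \<open>Rewrite rules to linear expressions in 1 and \<open>omega\<close>, so that sums of
  entries over phase space cancel by linear arithmetic.\<close>

lemma omega_powers:
  "omega\<^sup>2 = - 1 - omega" "omega * omega = - 1 - omega" "omega ^ 3 = 1" "omega ^ 4 = omega"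
  "omega ^ 5 = - 1 - omega" "omega ^ 6 = 1" "omega ^ 7 = omega" "omega ^ 8 = - 1 - omega"
  "omega ^ 10 = omega" "omega ^ 12 = 1"
proof -
  show w2: "omega\<^sup>2 = - 1 - omega"
    using omega_sum by (simp add: eq_diff_eq eq_neg_iff_add_eq_0 add_ac)
  then show "omega * omega = - 1 - omega" "omega ^ 3 = 1" "omega ^ 4 = omega" "omega ^ 5 = - 1 - omega"
    "omega ^ 6 = 1" "omega ^ 7 = omega" "omega ^ 8 = - 1 - omega" "omega ^ 10 = omega" "omega ^ 12 = 1"
    using omega_power_mod[of 3] omega_power_mod[of 4] omega_power_mod[of 5] omega_power_mod[of 6]
      omega_power_mod[of 7] omega_power_mod[of 8] omega_power_mod[of 10] omega_power_mod[of 12]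
    by (simp_all add: power2_eq_square)
qed

section \<open>Explicit matrices of the phase-space operators\<close>

lemma clock_Z_pow: "clock_Z ^\<^sub>m a = mat 3 3 (\<lambda>(i, j). if i = j then omega ^ (a * i) else 0)"
proof (induction a)
  case 0
  show ?case by (rule eq_matI) (auto simp: clock_Z_def)
next
  case (Suc a)
  have Z: "clock_Z = mat 3 3 (\<lambda>(i, j). if i = j then omega ^ j else 0)"
    by (rule eq_matI) (auto simp: clock_Z_def omega_def DeMoivre mult_ac)
  show ?case
    unfolding pow_mat.simps Suc
    unfolding Z
    by (rule eq_matI)
      (auto simp: scalar_prod_def if_distrib[of "\<lambda>x. x * _"] power_add mult_ac cong: if_cong)
qed

lemma shift_X_pow: "shift_X ^\<^sub>m a = mat 3 3 (\<lambda>(i, j). if i = (j + a) mod 3 then 1 else 0)"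
proof (induction a)
  case 0
  show ?case by (rule eq_matI) (auto simp: shift_X_def)
next
  case (Suc a)
  have mod: "((j + 1) mod 3 + a) mod 3 = (j + Suc a) mod 3" for j :: nat
    by (simp add: mod_add_left_eq)
  show ?case
    unfolding pow_mat.simps Suc
    by (rule eq_matI)
      (auto simp: shift_X_def scalar_prod_def if_distrib[of "\<lambda>x. _ * x"] mod[simplified] cong: if_cong)
qed

lemma phase_T_eq:
  "phase_T (a, b) = mat 3 3 (\<lambda>(i, j). if i = (j + b) mod 3 then omega ^ (a * b + a * i) else 0)"
proof -
  \<comment> \<open>As -2 and 1 agree modulo 3, the phase differs from that of
    \<open>omega ^ (a * b)\<close> by \<open>a * b\<close> full turns.\<close>
  have "cis (- (4 * pi * real a * real b / 3)) = cis (2 * pi * real (a * b) / 3 - 2 * pi * real (a * b))"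
    by (rule arg_cong[of _ _ cis]) (simp add: field_simps)
  also have "\<dots> = cis (2 * pi * real (a * b) / 3) / cis (2 * pi * real (a * b))"
    by (rule cis_divide[symmetric])
  also have "cis (2 * pi * real (a * b)) = 1"
    by (rule cis_multiple_2pi) simp
  also have "cis (2 * pi * real (a * b) / 3) / 1 = omega ^ (a * b)"
    by (simp add: omega_def DeMoivre mult_ac)
  finally have phase: "cis (- (4 * pi * real a * real b / 3)) = omega ^ (a * b)" .
  show ?thesis
    unfolding phase_T_def prod.case phase clock_Z_pow shift_X_pow
    by (rule eq_matI)
      (auto simp: scalar_prod_def if_distrib[of "\<lambda>x. x * _"] power_add cong: if_cong)
qed

lemma sum_Z3_points: "(\<Sum>u\<in>Z3_points. f u) = (\<Sum>a\<in>{0,1,2}. \<Sum>b\<in>{0,1,2}. f (a, b))"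
proof -
  have "{0..<3} = {0, 1, 2::nat}" by auto
  then show ?thesis
    unfolding Z3_points_def by (simp only: sum.cartesian_product split_def prod.collapse)
qed

text \<open>In entry \<open>(i, j)\<close> only \<open>b = i - j\<close> modulo 3 contributes, and
  the sum of \<open>omega ^ (a * (b + i))\<close> over \<open>a\<close> is 3 if 3 divides
  \<open>2 * i - j\<close>, equivalently \<open>i + j\<close>, and 0 otherwise.\<close>

lemma phase_A0_eq: "phase_A0 = mat 3 3 (\<lambda>(i, j). if (i + j) mod 3 = 0 then 1 else 0)"
proof -
  have "(\<Sum>u\<in>Z3_points. phase_T u $$ (i, j)) = (if (i + j) mod 3 = 0 then 3 else 0)"
    if "i < 3" "j < 3" for i j
    using that unfolding sum_Z3_points less_3_iff
    by (elim disjE) (simp_all add: phase_T_eq omega_powers)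
  then show ?thesis
    unfolding phase_A0_def by (intro eq_matI) auto
qed

text \<open>Conjugating the parity by a displacement gives the reflection that sends j to 2b - j
  modulo 3, with phases. Since \<open>2 * j\<close> and \<open>- j\<close> agree modulo 3, the phase
  is the power i - j of \<open>omega ^ a\<close>.\<close>

lemma phase_A_eq:
  assumes "b < 3"
  shows "phase_A (a, b) =
    mat 3 3 (\<lambda>(i, j). if (i + j) mod 3 = 2 * b mod 3 then (omega ^ a) ^ (i + 2 * j) else 0)"
proof -
  define x where "x = omega ^ a"
  have T: "phase_T (a, b) = mat 3 3 (\<lambda>(i, j). if i = (j + b) mod 3 then x ^ (b + i) else 0)"
    unfolding phase_T_eq x_def by (rule eq_matI) (auto simp: power_mult power_add)
  have cnj_x: "cnj x = x\<^sup>2"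
    by (simp add: x_def cnj_omega mult_ac flip: power_mult)
  have "x ^ 3 = (omega ^ 3) ^ a"
    by (simp add: x_def mult_ac flip: power_mult)
  then have x3: "x ^ 3 = 1"
    by (simp add: omega_pow3)
  have x_mod: "x ^ k = x ^ (k mod 3)" for k
  proof -
    have "x ^ k = (x ^ 3) ^ (k div 3) * x ^ (k mod 3)"
      by (simp flip: power_mult power_add)
    then show ?thesis by (simp add: x3)
  qed
  \<comment> \<open>Naming the square keeps powers of \<open>x\<close> and of its conjugate apart
    during the case analysis.\<close>
  define y where "y = x\<^sup>2"
  have adj: "mat_adjoint (mat 3 3 (\<lambda>(i, j). if i = (j + b) mod 3 then x ^ (b + i) else 0))
      = mat 3 3 (\<lambda>(i, j). if j = (i + b) mod 3 then y ^ (b + j) else 0)"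
    unfolding mat_adjoint_eq by (rule eq_matI) (simp_all add: cnj_x y_def)
  have upt: "{0..<3} = {0, 1, 2::nat}" by auto
  have "phase_A (a, b) $$ (i, j) = (if (i + j) mod 3 = 2 * b mod 3 then x ^ (i + 2 * j) else 0)"
    if "i < 3" "j < 3" for i j
  proof -
    have "phase_A (a, b) $$ (i, j) = (if (i + j) mod 3 = 2 * b mod 3 then x ^ (b + i) * (x\<^sup>2) ^ (b + j) else 0)"
      using that assms unfolding phase_A_def T adj phase_A0_eq y_def[symmetric] less_3_iff
      by (elim disjE) (simp_all add: scalar_prod_def upt)
    also have "x ^ (b + i) * (x\<^sup>2) ^ (b + j) = x ^ (b + i) * x ^ (2 * (b + j))"
      by (simp only: power_mult)
    also have "x ^ (b + i) * x ^ (2 * (b + j)) = x ^ (3 * b + (i + 2 * j))"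
      by (simp add: algebra_simps flip: power_add)
    also have "\<dots> = x ^ (i + 2 * j)"
      \<comment> \<open>The summand \<open>3 * b\<close> vanishes once exponents are reduced modulo
        3.\<close>
      by (subst (1 2) x_mod) simp
    finally show ?thesis .
  qed
  then show ?thesis
    unfolding x_def[symmetric]
    by (intro eq_matI) (auto simp: phase_A_def T mat_adjoint_eq)
qed

lemma phase_A_carrier [simp]: "phase_A u \<in> carrier_mat 3 3"
proof -
  have "phase_T u \<in> carrier_mat 3 3"
    by (cases u) (simp add: phase_T_eq)
  then show ?thesis
    by (intro carrier_matI) (simp_all add: phase_A_def mat_adjoint_eq)
qed

lemma phase_op_carrier: "us \<in> phase_space n \<Longrightarrow> phase_op us \<in> carrier_mat (3 ^ n) (3 ^ n)"
  using kron_list_carrier[of "map phase_A us" 3] by (auto simp: phase_op_def phase_space_def)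

text \<open>As 2 is invertible modulo 3, the reflection about \<open>b\<close> fixes
  \<open>b\<close> alone, and on the diagonal the phase is a power of \<open>omega ^ 3\<close>. This
  gives every trace needed for the Wigner function of a diagonal effect.\<close>

lemma phase_A_diag:
  assumes "b < 3" "i < 3"
  shows "phase_A (a, b) $$ (i, i) = (if i = b then 1 else 0)"
proof -
  have "(i + i) mod 3 = 2 * b mod 3 \<longleftrightarrow> i = b"
    using assms unfolding less_3_iff by (elim disjE) simp_all
  moreover have "(omega ^ a) ^ (i + 2 * i) = (omega ^ 3) ^ (a * i)"
    by (simp add: mult_ac flip: power_mult)
  then have "(omega ^ a) ^ (i + 2 * i) = 1"
    by (simp only: omega_pow3 power_one)
  ultimately show ?thesis
    using assms by (auto simp: phase_A_eq)
qed

lemma phase_A_origin: "phase_A (0, 0) = mat 3 3 (\<lambda>(i, j). if (i + j) mod 3 = 0 then 1 else 0)"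
  unfolding phase_A_eq[of 0 0, simplified] by (rule eq_matI) auto

text \<open>Summing over \<open>a\<close> cancels the off-diagonal entries as sums of the three cube
  roots of unity; each diagonal entry is 1 for exactly one \<open>b\<close> and all three
  \<open>a\<close>.\<close>

lemma sum_phase_A_eq_one:
  assumes "i < 3" "j < 3"
  shows "(\<Sum>u\<in>Z3_points. phase_A u $$ (i, j)) = 3 * (1\<^sub>m 3 $$ (i, j))"
  using assms unfolding sum_Z3_points less_3_iff
  by (elim disjE) (simp_all add: phase_A_eq omega_powers algebra_simps flip: power_mult)

section \<open>The two states as parity eigenprojections, and the effect as a diagonal
  projection\<close>

text \<open>The parity fixes the basis vector 0 and \<open>ket_K\<close> and negates
  \<open>strange\<close>, so \<open>rho0\<close> projects onto its eigenspace for -1.\<close>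

lemma rho0_eq: "rho0 = (1 / 2) \<cdot>\<^sub>m (1\<^sub>m 3 - phase_A (0, 0))"
proof -
  have "complex_of_real (1 / sqrt 2) * complex_of_real (1 / sqrt 2) = 1 / 2"
    by (simp flip: of_real_mult)
  then show ?thesis
    unfolding rho0_def ketbra_def strange_def phase_A_origin
    by (intro eq_matI) (auto simp: less_3_iff)
qed

lemma rho1_eq: "rho1 = (1 / 4) \<cdot>\<^sub>m (1\<^sub>m 3 + phase_A (0, 0))"
  unfolding rho1_def rho0_def[symmetric] rho0_eq
  by (rule eq_matI) (auto simp: phase_A_origin)

definition proj12 :: "complex mat" where
  "proj12 = mat 3 3 (\<lambda>(i, j). if i = j \<and> i \<noteq> 0 then 1 else 0)"

text \<open>\<open>ket_K\<close> and \<open>strange\<close> form an orthonormal basis of the span of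
  the basis vectors 1 and 2.\<close>

lemma ketbra_K_add_strange: "ketbra ket_K ket_K + ketbra strange strange = proj12"
proof -
  have "complex_of_real (1 / sqrt 2) * complex_of_real (1 / sqrt 2) = 1 / 2"
    by (simp flip: of_real_mult)
  then show ?thesis
    unfolding ketbra_def strange_def ket_K_def proj12_def
    by (intro eq_matI) (auto simp: less_3_iff)
qed

lemma E_opt_eq: "E_opt n = tensor_power n proj12"
  by (simp add: E_opt_def ketbra_K_add_strange)

lemma proj12_carrier [simp]: "proj12 \<in> carrier_mat 3 3"
  by (simp add: proj12_def)

lemma rho_carrier [simp]: "rho0 \<in> carrier_mat 3 3" "rho1 \<in> carrier_mat 3 3"
  by (intro carrier_matI; simp add: rho0_eq rho1_eq phase_A_origin)+

lemma proj12_idem: "proj12 * proj12 = proj12"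
  by (rule eq_matI)
    (auto simp: proj12_def scalar_prod_def if_distrib[of "\<lambda>x. x * _"] cong: if_cong)

lemma proj12_adjoint: "mat_adjoint proj12 = proj12"
  by (rule eq_matI) (auto simp: proj12_def mat_adjoint_eq)

lemma mtrace_3: "A \<in> carrier_mat 3 3 \<Longrightarrow> mtrace A = A $$ (0, 0) + A $$ (1, 1) + A $$ (2, 2)"
proof -
  have "{..<3} = {0, 1, 2::nat}" by auto
  then show "A \<in> carrier_mat 3 3 \<Longrightarrow> mtrace A = A $$ (0, 0) + A $$ (1, 1) + A $$ (2, 2)"
    by (simp add: mtrace_def add_ac)
qed

lemma mtrace_proj12_mult:
  assumes "A \<in> carrier_mat 3 3"
  shows "mtrace (proj12 * A) = A $$ (1, 1) + A $$ (2, 2)"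
proof -
  have upt: "{0..<3} = {0, 1, 2::nat}" by auto
  have "mtrace (proj12 * A) = (proj12 * A) $$ (0, 0) + (proj12 * A) $$ (1, 1) + (proj12 * A) $$ (2, 2)"
    using assms by (intro mtrace_3 mult_carrier_mat[of _ 3 3]) simp_all
  then show ?thesis
    using assms by (simp add: proj12_def scalar_prod_def upt)
qed

section \<open>The cone generated by the phase-space operators\<close>

text \<open>An effect with nonnegative Wigner function has nonnegative trace against every element
  of this cone. Closure under binary sums and scaling avoids indexed sums of matrices and provides
  an induction rule.\<close>

inductive wigner_cone :: "nat \<Rightarrow> complex mat \<Rightarrow> bool" for n where
  point: "us \<in> phase_space n \<Longrightarrow> wigner_cone n (phase_op us)"
| add: "wigner_cone n A \<Longrightarrow> wigner_cone n B \<Longrightarrow> wigner_cone n (A + B)"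
| smult: "wigner_cone n A \<Longrightarrow> 0 \<le> c \<Longrightarrow> wigner_cone n (c \<cdot>\<^sub>m A)"

lemma wigner_cone_carrier: "wigner_cone n M \<Longrightarrow> M \<in> carrier_mat (3 ^ n) (3 ^ n)"
  by (induction rule: wigner_cone.induct) (simp_all add: phase_op_carrier)

lemma wigner_cone_nonneg:
  assumes "wigner_cone n M" "E \<in> carrier_mat (3 ^ n) (3 ^ n)"
    and "\<forall>us \<in> phase_space n. 0 \<le> wigner E us"
  shows "0 \<le> mtrace (E * M)"
  using assms(1)
proof (induction rule: wigner_cone.induct)
  case (point us)
  then show ?case using assms(3) by (simp add: wigner_def)
next
  case (add A B)
  note c = add.hyps[THEN wigner_cone_carrier]
  have "mtrace (E * (A + B)) = mtrace (E * A) + mtrace (E * B)"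
    using assms(2) c by (simp add: mult_add_distrib_mat mtrace_add[of _ "3 ^ n"])
  then show ?case using add.IH by simp
next
  case (smult A c)
  note A = wigner_cone_carrier[OF smult.hyps(1)]
  have "mtrace (E * (c \<cdot>\<^sub>m A)) = c * mtrace (E * A)"
    using assms(2) A by (simp add: mult_smult_distrib mtrace_smult[of _ "3 ^ n"])
  then show ?case using smult by (simp add: less_eq_complex_def)
qed

lemma kron_add_right:
  "A \<in> carrier_mat m m \<Longrightarrow> M \<in> carrier_mat n n \<Longrightarrow> N \<in> carrier_mat n n \<Longrightarrow>
    kron A (M + N) = kron A M + kron A N"
  by (rule eq_matI) (auto simp: index_kron div_mod_less algebra_simps)

lemma kron_smult_right: "kron A (c \<cdot>\<^sub>m M) = c \<cdot>\<^sub>m kron A M"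
  by (rule eq_matI) (auto simp: index_kron div_mod_less)

text \<open>On generators this puts one more point in front of the list; the other cases follow from
  bilinearity of \<open>kron\<close>.\<close>

lemma wigner_cone_kron_phase_A:
  assumes "wigner_cone n M" "u \<in> Z3_points"
  shows "wigner_cone (Suc n) (kron (phase_A u) M)"
  using assms(1)
proof (induction rule: wigner_cone.induct)
  case (point us)
  then have "u # us \<in> phase_space (Suc n)"
    using assms(2) by (simp add: phase_space_def)
  from wigner_cone.point[OF this] show ?case by (simp add: phase_op_def)
next
  case (add A B)
  have "kron (phase_A u) (A + B) = kron (phase_A u) A + kron (phase_A u) B"
    by (rule kron_add_right[OF phase_A_carrier]) (use add.hyps wigner_cone_carrier in auto)
  then show ?case using wigner_cone.add[OF add.IH] by simp
next
  case (smult A c)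
  then show ?case using wigner_cone.smult[OF smult.IH] by (simp add: kron_smult_right)
qed

text \<open>The identity factor is a third of the sum of the nine single-qutrit operators, and each
  of these preserves the cone.\<close>

lemma wigner_cone_kron_one:
  assumes M: "wigner_cone n M"
  shows "wigner_cone (Suc n) (kron (1\<^sub>m 3) M)"
proof -
  let ?K = "\<lambda>a b. kron (phase_A (a, b)) M"
  \<comment> \<open>All nine points are written out because the cone is closed under binary
    sums.\<close>
  let ?S = "?K 0 0 + ?K 0 1 + ?K 0 2 + ?K 1 0 + ?K 1 1 + ?K 1 2 + ?K 2 0 + ?K 2 1 + ?K 2 2"
  have cone: "wigner_cone (Suc n) (?K a b)" if "a < 3" "b < 3" for a b
    using that by (intro wigner_cone_kron_phase_A[OF M]) (simp add: Z3_points_def)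
  have "wigner_cone (Suc n) ((1 / 3) \<cdot>\<^sub>m ?S)"
    by (intro wigner_cone.smult wigner_cone.add cone) (simp_all add: less_eq_complex_def)
  moreover have "(1 / 3) \<cdot>\<^sub>m ?S = kron (1\<^sub>m 3) M"
  proof (rule eq_matI)
    fix i j assume "i < dim_row (kron (1\<^sub>m 3) M)" "j < dim_col (kron (1\<^sub>m 3) M)"
    then have ij: "i < 3 * 3 ^ n" "j < 3 * 3 ^ n"
      using wigner_cone_carrier[OF M] by auto
    note ij' = div_mod_less[OF ij(1)] div_mod_less[OF ij(2)]
    have "(\<Sum>u\<in>Z3_points. f u) = f (0,0) + f (0,1) + f (0,2) + f (1,0) + f (1,1) + f (1,2)
        + f (2,0) + f (2,1) + f (2,2)" for f :: "nat \<times> nat \<Rightarrow> complex"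
      by (simp add: sum_Z3_points add_ac)
    note sum = this[of "\<lambda>u. phase_A u $$ (i div 3 ^ n, j div 3 ^ n)"]
    have "((1 / 3) \<cdot>\<^sub>m ?S) $$ (i, j) = 1 / 3 *
        (\<Sum>u\<in>Z3_points. phase_A u $$ (i div 3 ^ n, j div 3 ^ n)) * M $$ (i mod 3 ^ n, j mod 3 ^ n)"
      unfolding sum using ij wigner_cone_carrier[OF M]
      by (simp add: index_kron carrier_matD[OF phase_A_carrier] algebra_simps)
    also have "\<dots> = kron (1\<^sub>m 3) M $$ (i, j)"
      using ij ij' wigner_cone_carrier[OF M]
      by (subst sum_phase_A_eq_one) (auto simp: index_kron)
    finally show "((1 / 3) \<cdot>\<^sub>m ?S) $$ (i, j) = kron (1\<^sub>m 3) M $$ (i, j)" .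
  qed (use wigner_cone_carrier[OF M] in \<open>simp_all add: carrier_matD[OF phase_A_carrier]\<close>)
  ultimately show ?thesis by simp
qed

text \<open>Grouping by the first factor, 1 or \<open>A\<close>, leaves only \<open>P + M\<close>
  and \<open>P - M\<close> with positive coefficients. This recursion replaces the expansion of the
  tensor powers.\<close>

lemma kron_parity_split:
  assumes "A \<in> carrier_mat m m" "P \<in> carrier_mat k k" "M \<in> carrier_mat k k"
  shows "kron ((1 / 2) \<cdot>\<^sub>m (1\<^sub>m m + A)) P + kron ((1 / 2) \<cdot>\<^sub>m (1\<^sub>m m - A)) M
      = (1 / 2) \<cdot>\<^sub>m (kron (1\<^sub>m m) (P + M) + kron A (P - M))" (is ?plus)
    and "kron ((1 / 2) \<cdot>\<^sub>m (1\<^sub>m m + A)) P - kron ((1 / 2) \<cdot>\<^sub>m (1\<^sub>m m - A)) M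
      = (1 / 2) \<cdot>\<^sub>m (kron (1\<^sub>m m) (P - M) + kron A (P + M))" (is ?minus)
proof -
  note [simp] = carrier_matD[OF assms(1)] carrier_matD[OF assms(2)] carrier_matD[OF assms(3)]
  show ?plus ?minus
    by (rule eq_matI; simp add: index_kron div_mod_less field_simps)+
qed

text \<open>The difference is what the lower bound needs; the sum is carried along because each of
  the two for \<open>Suc n\<close> is built from both for \<open>n\<close>.\<close>

lemma wigner_cone_rho_powers:
  "wigner_cone n (2 ^ n \<cdot>\<^sub>m tensor_power n rho1 + tensor_power n rho0) \<and>
   wigner_cone n (2 ^ n \<cdot>\<^sub>m tensor_power n rho1 - tensor_power n rho0)"
proof (induction n)
  case 0
  have "wigner_cone 0 (phase_op [])"
    by (intro wigner_cone.point) (simp add: phase_space_def)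
  then have one: "wigner_cone 0 (c \<cdot>\<^sub>m 1\<^sub>m 1)" if "0 \<le> c" for c
    using that wigner_cone.smult[of 0 "phase_op []" c] by (simp add: phase_op_def)
  \<comment> \<open>Without qutrits the sum is 2 and the difference 0; scaling by 0 puts the latter
    in the cone.\<close>
  have "2 ^ 0 \<cdot>\<^sub>m tensor_power 0 rho1 + tensor_power 0 rho0 = 2 \<cdot>\<^sub>m 1\<^sub>m 1"
    "2 ^ 0 \<cdot>\<^sub>m tensor_power 0 rho1 - tensor_power 0 rho0 = 0 \<cdot>\<^sub>m 1\<^sub>m 1"
    by (auto intro!: eq_matI)
  then show ?case using one[of 2] one[of 0] by (simp add: less_eq_complex_def)
next
  case (Suc n)
  let ?P = "2 ^ n \<cdot>\<^sub>m tensor_power n rho1" and ?M = "tensor_power n rho0"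
  let ?A = "phase_A (0, 0)"
  have A: "wigner_cone (Suc n) (kron ?A N)" if "wigner_cone n N" for N
    using that by (intro wigner_cone_kron_phase_A) (simp_all add: Z3_points_def)
  have P: "?P \<in> carrier_mat (3 ^ n) (3 ^ n)" and M: "?M \<in> carrier_mat (3 ^ n) (3 ^ n)"
    by simp_all
  \<comment> \<open>One factor 2 goes to the first qutrit, where it makes \<open>rho1\<close> a
    projection; the others stay with the tail.\<close>
  have "2 ^ Suc n \<cdot>\<^sub>m tensor_power (Suc n) rho1 = kron (2 \<cdot>\<^sub>m rho1) ?P"
    by (rule eq_matI) (simp_all add: index_kron div_mod_less)
  also have "2 \<cdot>\<^sub>m rho1 = (1 / 2) \<cdot>\<^sub>m (1\<^sub>m 3 + ?A)"
    by (rule eq_matI) (simp_all add: rho1_eq)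
  finally have rho1: "2 ^ Suc n \<cdot>\<^sub>m tensor_power (Suc n) rho1
    = kron ((1 / 2) \<cdot>\<^sub>m (1\<^sub>m 3 + ?A)) ?P" .
  have rho0: "tensor_power (Suc n) rho0 = kron ((1 / 2) \<cdot>\<^sub>m (1\<^sub>m 3 - ?A)) ?M"
    using rho0_eq by simp
  have half: "0 \<le> (1 / 2 :: complex)" by (simp add: less_eq_complex_def)
  show ?case
    unfolding rho1 rho0 kron_parity_split[OF phase_A_carrier P M]
    using Suc half by (blast intro: wigner_cone.smult wigner_cone.add A wigner_cone_kron_one)
qed

section \<open>The claimed measurement is a PWF POVM\<close>

lemma mtrace_minus:
  "A \<in> carrier_mat n n \<Longrightarrow> B \<in> carrier_mat n n \<Longrightarrow> mtrace (A - B) = mtrace A - mtrace B"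
  by (simp add: mtrace_def sum_subtractf)

text \<open>The diagonal of \<open>phase_A (a, b)\<close> is a single 1 at position
  \<open>b\<close>, and \<open>proj12\<close> removes it exactly when \<open>b = 0\<close>.\<close>

lemma mtrace_phase_A:
  assumes "u \<in> Z3_points"
  shows "mtrace (phase_A u) = 1" "mtrace (proj12 * phase_A u) \<in> {0, 1}"
proof -
  obtain a b where u: "u = (a, b)" "b < 3"
    using assms by (auto simp: Z3_points_def)
  then show "mtrace (phase_A u) = 1" "mtrace (proj12 * phase_A u) \<in> {0, 1}"
    by (auto simp: mtrace_3 mtrace_proj12_mult phase_A_diag less_3_iff)
qed

lemma mtrace_phase_op:
  assumes "us \<in> phase_space n"
  shows "mtrace (phase_op us) = 1"
proof -
  have "mtrace (phase_op us) = prod_list (map mtrace (map phase_A us))"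
    unfolding phase_op_def by (rule mtrace_kron_list[where d = 3]) simp
  moreover have "set us \<subseteq> Z3_points \<Longrightarrow> prod_list (map mtrace (map phase_A us)) = 1"
    by (induction us) (simp_all add: mtrace_phase_A)
  ultimately show ?thesis using assms by (simp add: phase_space_def)
qed

text \<open>The value is a product of single-qutrit values, each 0 or 1. The bound by 1 is what
  makes the complementary effect positive too.\<close>

lemma wigner_E_opt:
  assumes "us \<in> phase_space n"
  shows "wigner (E_opt n) us \<in> {0, 1}"
proof -
  have len: "length (map phase_A us) = n" using assms by (simp add: phase_space_def)
  have "E_opt n * phase_op us = kron_list (map ((*) proj12) (map phase_A us))"
    unfolding E_opt_eq phase_op_def len[symmetric]
    by (rule tensor_power_mult_kron_list[where d = 3]) simp_all
  moreover have "mtrace (kron_list (map ((*) proj12) (map phase_A us)))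
      = prod_list (map mtrace (map ((*) proj12) (map phase_A us)))"
    by (rule mtrace_kron_list[where d = 3]) (auto intro: mult_carrier_mat[of _ 3 3])
  moreover have "set us \<subseteq> Z3_points \<Longrightarrow>
      prod_list (map mtrace (map ((*) proj12) (map phase_A us))) \<in> {0, 1}"
  proof (induction us)
    case (Cons u us)
    then show ?case using mtrace_phase_A(2)[of u] by auto
  qed simp
  ultimately show ?thesis using assms by (simp add: wigner_def phase_space_def)
qed

text \<open>Phase-space operators have trace 1, so the identity has constant Wigner function
  1.\<close>

lemma wigner_compl:
  assumes "F \<in> carrier_mat (3 ^ n) (3 ^ n)" "us \<in> phase_space n"
  shows "wigner (1\<^sub>m (3 ^ n) - F) us = 1 - wigner F us"
proof -
  note op = phase_op_carrier[OF assms(2)]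
  have "(1\<^sub>m (3 ^ n) - F) * phase_op us = phase_op us - F * phase_op us"
    using minus_mult_distrib_mat[OF one_carrier_mat assms(1) op] op by simp
  then show ?thesis
    using op assms mtrace_minus[OF op mult_carrier_mat[OF assms(1) op]]
    by (simp add: wigner_def mtrace_phase_op[OF assms(2)])
qed

lemma E_opt_carrier: "E_opt n \<in> carrier_mat (3 ^ n) (3 ^ n)"
  unfolding E_opt_eq by (rule tensor_power_carrier) simp

lemma pwf_povm_E_opt: "pwf_povm n (E_opt n, 1\<^sub>m (3 ^ n) - E_opt n)"
proof -
  have adj: "mat_adjoint (E_opt n) = E_opt n"
    by (simp add: E_opt_eq mat_adjoint_tensor_power proj12_adjoint)
  have idem: "E_opt n * E_opt n = E_opt n"
    by (simp add: E_opt_eq tensor_power_mult[OF proj12_carrier proj12_carrier] proj12_idem)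
  have sum: "E_opt n + (1\<^sub>m (3 ^ n) - E_opt n) = 1\<^sub>m (3 ^ n)"
    using E_opt_carrier[of n] by (intro eq_matI) auto
  have "0 \<le> wigner (E_opt n) us \<and> 0 \<le> wigner (1\<^sub>m (3 ^ n) - E_opt n) us"
    if "us \<in> phase_space n" for us
    using wigner_E_opt[OF that] wigner_compl[OF E_opt_carrier that]
    by (auto simp: less_eq_complex_def)
  then show ?thesis
    using psd_projection[OF E_opt_carrier adj idem] psd_projection_compl[OF E_opt_carrier adj idem] sum
    by (simp add: pwf_povm_def)
qed

section \<open>Error probability: the attained value and the lower bound\<close>

lemma mtrace_rho0: "mtrace rho0 = 1"
  unfolding mtrace_3[OF rho_carrier(1)] by (simp add: rho0_eq phase_A_origin)

text \<open>\<open>rho0\<close> is supported in the range of \<open>proj12\<close>, so it is never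
  misidentified. \<open>rho1\<close> is the even mixture of the basis vector 0 and
  \<open>ket_K\<close>, so each qutrit passes with probability 1/2; the prior contributes the last
  factor 1/2.\<close>

lemma error_prob_E_opt:
  "error_prob (tensor_power n rho0) (tensor_power n rho1) (1 / 2) (E_opt n, 1\<^sub>m (3 ^ n) - E_opt n)
    = 1 / 2 ^ (n + 1)"
proof -
  have r0: "tensor_power n rho0 \<in> carrier_mat (3 ^ n) (3 ^ n)" by simp
  have "mtrace (proj12 * rho1) = 1 / 2" "mtrace (proj12 * rho0) = 1"
    by (simp_all add: mtrace_proj12_mult) (simp_all add: rho0_eq rho1_eq phase_A_origin)
  moreover have "mtrace (E_opt n * tensor_power n A) = mtrace (proj12 * A) ^ n"
    if "A \<in> carrier_mat 3 3" for A
    using that by (simp add: E_opt_eq tensor_power_mult[of _ 3] mtrace_tensor_power[of _ 3]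
        mult_carrier_mat[of _ 3 3])
  ultimately have tr: "mtrace (E_opt n * tensor_power n rho1) = (1 / 2) ^ n"
    "mtrace (E_opt n * tensor_power n rho0) = 1"
    by (simp_all only: rho_carrier power_one)
  have "(1\<^sub>m (3 ^ n) - E_opt n) * tensor_power n rho0 = tensor_power n rho0 - E_opt n * tensor_power n rho0"
    using minus_mult_distrib_mat[OF one_carrier_mat E_opt_carrier r0] r0 by simp
  then have "mtrace ((1\<^sub>m (3 ^ n) - E_opt n) * tensor_power n rho0) = 0"
    using mtrace_minus[OF r0 mult_carrier_mat[OF E_opt_carrier r0]] tr
    by (simp add: mtrace_tensor_power[of _ 3] mtrace_rho0)
  moreover have "(1 / 2 :: complex) ^ n = complex_of_real ((1 / 2) ^ n)" by simp
  ultimately show ?thesis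
    unfolding error_prob_def prod.case tr by (simp only: Re_complex_of_real) (simp add: power_divide)
qed

lemma error_prob_ge:
  assumes "pwf_povm n E"
  shows "1 / 2 ^ (n + 1) \<le> error_prob (tensor_power n rho0) (tensor_power n rho1) (1 / 2) E"
proof -
  obtain E0 E1 where E: "E = (E0, E1)" by fastforce
  let ?R0 = "tensor_power n rho0" and ?R1 = "tensor_power n rho1"
  have psd: "psd (3 ^ n) E1" and sum: "E0 + E1 = 1\<^sub>m (3 ^ n)"
    and c: "E0 \<in> carrier_mat (3 ^ n) (3 ^ n)" "E1 \<in> carrier_mat (3 ^ n) (3 ^ n)"
    and W: "\<forall>us \<in> phase_space n. 0 \<le> wigner E0 us"
    using assms by (auto simp: E pwf_povm_def psd_def)
  have R: "?R0 \<in> carrier_mat (3 ^ n) (3 ^ n)" "?R1 \<in> carrier_mat (3 ^ n) (3 ^ n)" by simp_all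
  have "strange \<in> carrier_vec 3" by (simp add: strange_def)
  then obtain w where w: "w \<in> carrier_vec (3 ^ n)" "?R0 = ketbra w w"
    using tensor_power_ketbra unfolding rho0_def by blast
  \<comment> \<open>As \<open>?R0\<close> has rank one, this trace is the quadratic form of
    \<open>E1\<close> at \<open>w\<close>.\<close>
  have "0 \<le> mtrace (E1 * ?R0)"
    using psd w c by (simp add: mtrace_mult_ketbra psd_def)
  then have t1: "0 \<le> Re (mtrace (E1 * ?R0))"
    by (simp add: less_eq_complex_def)
  have "mtrace (E0 * ?R0) + mtrace (E1 * ?R0) = mtrace ((E0 + E1) * ?R0)"
    using add_mult_distrib_mat[OF c R(1)] c R
      mtrace_add[OF mult_carrier_mat[OF c(1) R(1)] mult_carrier_mat[OF c(2) R(1)]] by simp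
  also have "\<dots> = 1"
    unfolding sum left_mult_one_mat[OF R(1)] by (simp add: mtrace_tensor_power[of _ 3] mtrace_rho0)
  finally have "Re (mtrace (E0 * ?R0) + mtrace (E1 * ?R0)) = Re 1" by simp
  then have t0: "Re (mtrace (E0 * ?R0)) = 1 - Re (mtrace (E1 * ?R0))" by simp
  \<comment> \<open>The PWF condition enters here: the difference lies in the cone, against which
    \<open>E0\<close> has nonnegative trace.\<close>
  have "0 \<le> mtrace (E0 * (2 ^ n \<cdot>\<^sub>m ?R1 - ?R0))"
    using wigner_cone_rho_powers[of n] c W by (intro wigner_cone_nonneg) auto
  also have "E0 * (2 ^ n \<cdot>\<^sub>m ?R1 - ?R0) = 2 ^ n \<cdot>\<^sub>m (E0 * ?R1) - E0 * ?R0"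
    using mult_minus_distrib_mat[OF c(1) smult_carrier_mat[OF R(2)] R(1)]
    by (simp only: mult_smult_distrib[OF c(1) R(2)])
  also have "mtrace \<dots> = complex_of_real (2 ^ n) * mtrace (E0 * ?R1) - mtrace (E0 * ?R0)"
    using mtrace_minus[OF smult_carrier_mat[OF mult_carrier_mat[OF c(1) R(2)]] mult_carrier_mat[OF c(1) R(1)]]
    by (simp add: mtrace_smult[OF mult_carrier_mat[OF c(1) R(2)]])
  finally have "0 \<le> Re (complex_of_real (2 ^ n) * mtrace (E0 * ?R1) - mtrace (E0 * ?R0))"
    by (simp only: less_eq_complex_def zero_complex.sel)
  then have "Re (mtrace (E0 * ?R0)) \<le> 2 ^ n * Re (mtrace (E0 * ?R1))"
    by simp
  with t0 have "1 \<le> 2 ^ n * Re (mtrace (E0 * ?R1)) + Re (mtrace (E1 * ?R0))" by simp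
  \<comment> \<open>Since \<open>2 ^ n\<close> is at least 1, the nonnegative second term may be
    enlarged to share this factor; the remaining bracket is twice the error probability.\<close>
  also have "\<dots> \<le> 2 ^ n * Re (mtrace (E0 * ?R1)) + 2 ^ n * Re (mtrace (E1 * ?R0))"
    using mult_right_mono[OF one_le_power[of 2 n] t1] by simp
  finally have "1 \<le> 2 ^ n * (Re (mtrace (E0 * ?R1)) + Re (mtrace (E1 * ?R0)))"
    by (simp only: distrib_left)
  then show ?thesis
    by (simp add: E error_prob_def field_simps)
qed

theorem proposition5:
  fixes n :: nat
  assumes "n > 0"
  shows "P_e_PWF n (tensor_power n rho0) (tensor_power n rho1) (1 / 2) = 1 / 2 ^ (n + 1)
    \<and> is_arg_min (error_prob (tensor_power n rho0) (tensor_power n rho1) (1 / 2)) (pwf_povm n)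
        (E_opt n, 1\<^sub>m (3 ^ n) - E_opt n)"
proof
  show "P_e_PWF n (tensor_power n rho0) (tensor_power n rho1) (1 / 2) = 1 / 2 ^ (n + 1)"
    unfolding P_e_PWF_def
  \<comment> \<open>The infimum is attained at the claimed POVM, so its value there and the lower
    bound determine it.\<close>
  proof (rule cInf_eq_minimum)
    show "1 / 2 ^ (n + 1) \<in> error_prob (tensor_power n rho0) (tensor_power n rho1) (1 / 2) ` {E. pwf_povm n E}"
      using error_prob_E_opt[of n] pwf_povm_E_opt[of n] by (metis imageI mem_Collect_eq)
  qed (use error_prob_ge in blast)
  show "is_arg_min (error_prob (tensor_power n rho0) (tensor_power n rho1) (1 / 2)) (pwf_povm n)
      (E_opt n, 1\<^sub>m (3 ^ n) - E_opt n)"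
    unfolding is_arg_min_def error_prob_E_opt
    using pwf_povm_E_opt error_prob_ge by (auto simp: not_less)
qed

end
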